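(* Let $X$ be a space with walls. Every automorphism of spaces with walls $f\colon X\to X$ has a unique extension to a median automorphism $f_*\colon \mathcal{C}^1(X)\to\mathcal{C}^1(X)$, that is, a median automorphism with $f_*(\sigma_x)=\sigma_{f(x)}$ for all $x\in X$; this $f_*$ is a graph automorphism and is given by $f_*(\omega)=f(\omega)=\{f(A): A\in\omega\}$. Consequently, any action of a group $G$ on $X$ by automorphisms of spaces with walls has a unique extension to an action of $G$ on the graph $\mathcal{C}^1(X)$ by graph automorphisms, that is, an action with $g\cdot\sigma_x=\sigma_{g x}$ for all $g\in G$, $x\in X$.
   Context: **Spaces with walls.** Let $X$ be a set. A wall in $X$ is a partition $\{A,A^c\}$ of $X$ into two subsets (one of which may be empty), called halfspaces; $A^c=X\setminus A$. A wall separates two distinct points if one of them belongs to one of its halfspaces and the other to the other halfspace. $X$ is a space with walls if it is endowed with a collection of walls that contains the trivial wall $\{\emptyset,X\}$ and is such that any two distinct points are separated by a finite, non-zero number of walls of the collection. The halfspaces of $X$ are the halfspaces of walls in the given collection. A morphism of spaces with walls is a map $f\colon X\to X'$ between spaces with walls such that $f^{-1}(A')$ is a halfspace of $X$ for each halfspace $A'$ of $X'$. An automorphism is a bijective morphism $X\to X$ whose inverse is a morphism (equivalently, a bijection permuting the walls). **The graph $\mathcal{C}^1(X)$.** An ultrafilter on $X$ is a nonempty collection $\omega$ of halfspaces of $X$ such that (i) $A\in\omega$, $B$ a halfspace, and $A\subseteq B$ imply $B\in\omega$; (ii) for each halfspace $A$, either $A\in\omega$ or $A^c\in\omega$ but not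 both. For $x\in X$ the principal ultrafilter $\sigma_x$ is the collection of halfspaces containing $x$. An ultrafilter $\omega$ is almost principal if the symmetric difference $\omega\triangle\sigma_x$ is finite for some (equivalently, every) $x\in X$. $\mathcal{C}^1(X)$ is the graph whose vertices are the almost principal ultrafilters, with $\omega_1,\omega_2$ adjacent iff $\frac12|\omega_1\triangle\omega_2|=1$. It is connected and is a median graph: with $[\omega_1,\omega_2]$ the set of vertices on shortest paths from $\omega_1$ to $\omega_2$, the sets $[\omega_1,\omega_2],[\omega_2,\omega_3],[\omega_3,\omega_1]$ have a unique common point for all vertices $\omega_1,\omega_2,\omega_3$. A median morphism between median graphs is a map $h$ of vertex sets with $h([u,v])\subseteq[h(u),h(v)]$ for all vertices $u,v$; a median automorphism is a bijective median morphism from a median graph to itself whose inverse is a median morphism. *)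

theory Defs
  imports
    "HOL-Algebra.Group_Action"
    "Graph_Theory.Pair_Digraph"
    "Graph_Theory.Vertex_Walk"
begin

section \<open>Spaces with walls\<close>

definition is_wall :: "'a set \<Rightarrow> 'a set set \<Rightarrow> bool" where
  "is_wall X w \<longleftrightarrow> (\<exists>A. A \<subseteq> X \<and> w = {A, X - A})"

definition separates :: "'a set set \<Rightarrow> 'a \<Rightarrow> 'a \<Rightarrow> bool" where
  "separates w x y \<longleftrightarrow> (\<exists>A\<in>w. \<exists>B\<in>w. A \<noteq> B \<and> x \<in> A \<and> y \<in> B)"

locale space_with_walls =
  fixes X :: "'a set" and W :: "'a set set set"
  assumes walls: "w \<in> W \<Longrightarrow> is_wall X w"
    and trivial_wall: "{{}, X} \<in> W"
    and finite_separating: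
      "\<lbrakk>x \<in> X; y \<in> X; x \<noteq> y\<rbrakk> \<Longrightarrow> finite {w \<in> W. separates w x y}"
    and nonempty_separating:
      "\<lbrakk>x \<in> X; y \<in> X; x \<noteq> y\<rbrakk> \<Longrightarrow> {w \<in> W. separates w x y} \<noteq> {}"

definition halfspaces :: "'a set set set \<Rightarrow> 'a set set" where
  "halfspaces W = \<Union>W"

definition wall_morphism ::
  "'a set \<Rightarrow> 'a set set set \<Rightarrow> 'b set \<Rightarrow> 'b set set set \<Rightarrow> ('a \<Rightarrow> 'b) \<Rightarrow> bool" where
  "wall_morphism X W X' W' f \<longleftrightarrow>
     f \<in> X \<rightarrow> X' \<and> (\<forall>A'\<in>halfspaces W'. f -` A' \<inter> X \<in> halfspaces W)"

definition wall_automorphism :: "'a set \<Rightarrow> 'a set set set \<Rightarrow> ('a \<Rightarrow> 'a) \<Rightarrow> bool" where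
  "wall_automorphism X W f \<longleftrightarrow>
     bij_betw f X X \<and> wall_morphism X W X W f \<and> wall_morphism X W X W (inv_into X f)"


section \<open>Median graphs\<close>

text \<open>
  A simple graph, possibly infinite, is a \<^typ>\<open>'v pair_pre_digraph\<close> with a symmetric
  irreflexive set of arcs.
\<close>

definition shortest_vpath ::
  "'v pair_pre_digraph \<Rightarrow> 'v \<Rightarrow> 'v vwalk \<Rightarrow> 'v \<Rightarrow> bool" where
  "shortest_vpath G u p v \<longleftrightarrow>
     vpath p (with_proj G) \<and> hd p = u \<and> last p = v \<and>
     (\<forall>q. vpath q (with_proj G) \<and> hd q = u \<and> last q = v
        \<longrightarrow> vwalk_length p \<le> vwalk_length q)"

definition interval :: "'v pair_pre_digraph \<Rightarrow> 'v \<Rightarrow> 'v \<Rightarrow> 'v set" where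
  "interval G u v = {w. \<exists>p. shortest_vpath G u p v \<and> w \<in> set p}"

text \<open>
  The empty graph counts as connected here, unlike in the library's notion of a connected
  digraph: it is the graph attached to the empty space with walls.
\<close>

definition median_graph :: "'v pair_pre_digraph \<Rightarrow> bool" where
  "median_graph G \<longleftrightarrow>
     pair_bidirected_digraph G \<and>
     (\<forall>u\<in>pverts G. \<forall>v\<in>pverts G. reachable (with_proj G) u v) \<and>
     (\<forall>u\<in>pverts G. \<forall>v\<in>pverts G. \<forall>w\<in>pverts G.
        \<exists>!m. m \<in> interval G u v \<inter> interval G v w \<inter> interval G w u)"

definition median_morphism ::
  "'v pair_pre_digraph \<Rightarrow> 'w pair_pre_digraph \<Rightarrow> ('v \<Rightarrow> 'w) \<Rightarrow> bool" where
  "median_morphism G H h \<longleftrightarrow>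
     median_graph G \<and> median_graph H \<and> h \<in> pverts G \<rightarrow> pverts H \<and>
     (\<forall>u\<in>pverts G. \<forall>v\<in>pverts G. h ` interval G u v \<subseteq> interval H (h u) (h v))"

definition median_automorphism :: "'v pair_pre_digraph \<Rightarrow> ('v \<Rightarrow> 'v) \<Rightarrow> bool" where
  "median_automorphism G h \<longleftrightarrow>
     bij_betw h (pverts G) (pverts G) \<and> median_morphism G G h \<and>
     median_morphism G G (inv_into (pverts G) h)"

definition graph_automorphism :: "'v pair_pre_digraph \<Rightarrow> ('v \<Rightarrow> 'v) \<Rightarrow> bool" where
  "graph_automorphism G h \<longleftrightarrow>
     bij_betw h (pverts G) (pverts G) \<and>
     (\<forall>u\<in>pverts G. \<forall>v\<in>pverts G. (u, v) \<in> parcs G \<longleftrightarrow> (h u, h v) \<in> parcs G)"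


section \<open>The graph of almost principal ultrafilters\<close>

definition wall_ultrafilter :: "'a set \<Rightarrow> 'a set set set \<Rightarrow> 'a set set \<Rightarrow> bool" where
  "wall_ultrafilter X W \<omega> \<longleftrightarrow>
     \<omega> \<noteq> {} \<and> \<omega> \<subseteq> halfspaces W \<and>
     (\<forall>A\<in>\<omega>. \<forall>B\<in>halfspaces W. A \<subseteq> B \<longrightarrow> B \<in> \<omega>) \<and>
     (\<forall>A\<in>halfspaces W. (A \<in> \<omega> \<or> X - A \<in> \<omega>) \<and> \<not> (A \<in> \<omega> \<and> X - A \<in> \<omega>))"

definition principal :: "'a set set set \<Rightarrow> 'a \<Rightarrow> 'a set set" where
  "principal W x = {A \<in> halfspaces W. x \<in> A}"

definition almost_principal :: "'a set \<Rightarrow> 'a set set set \<Rightarrow> 'a set set \<Rightarrow> bool" where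
  "almost_principal X W \<omega> \<longleftrightarrow>
     wall_ultrafilter X W \<omega> \<and> (\<exists>x\<in>X. finite (sym_diff \<omega> (principal W x)))"

definition C1 :: "'a set \<Rightarrow> 'a set set set \<Rightarrow> 'a set set pair_pre_digraph" where
  "C1 X W =
     \<lparr>pverts = {\<omega>. almost_principal X W \<omega>},
      parcs = {(\<omega>\<^sub>1, \<omega>\<^sub>2). almost_principal X W \<omega>\<^sub>1 \<and> almost_principal X W \<omega>\<^sub>2 \<and>
                 (1 / 2 :: rat) * of_nat (card (sym_diff \<omega>\<^sub>1 \<omega>\<^sub>2)) = 1}\<rparr>"


section \<open>Extensions of maps and of actions\<close>

definition extends_to_C1 ::
  "'a set \<Rightarrow> 'a set set set \<Rightarrow> ('a \<Rightarrow> 'a) \<Rightarrow> ('a set set \<Rightarrow> 'a set set) \<Rightarrow> bool" where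
  "extends_to_C1 X W f h \<longleftrightarrow> (\<forall>x\<in>X. h (principal W x) = principal W (f x))"

definition wall_action ::
  "('g, 'm) monoid_scheme \<Rightarrow> 'a set \<Rightarrow> 'a set set set \<Rightarrow> ('g \<Rightarrow> 'a \<Rightarrow> 'a) \<Rightarrow> bool" where
  "wall_action G X W \<phi> \<longleftrightarrow>
     group_action G X \<phi> \<and> (\<forall>g\<in>carrier G. wall_automorphism X W (\<phi> g))"

definition graph_action ::
  "('g, 'm) monoid_scheme \<Rightarrow> 'v pair_pre_digraph \<Rightarrow> ('g \<Rightarrow> 'v \<Rightarrow> 'v) \<Rightarrow> bool" where
  "graph_action G \<Gamma> \<psi> \<longleftrightarrow>
     group_action G (pverts \<Gamma>) \<psi> \<and> (\<forall>g\<in>carrier G. graph_automorphism \<Gamma> (\<psi> g))"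

end

theory Submission
  imports Defs
begin

text \<open>
  A wall automorphism \<open>f\<close> permutes the halfspaces, so taking images of halfspaces turns almost
  principal ultrafilters into almost principal ultrafilters. This is the required extension;
  the substance of the theorem is that the graph is median, so that median morphisms make sense
  at all, and that there is no other extension.

  Both rest on one formula: the graph distance of two vertices is the number of halfspaces in
  \<open>u - v\<close>, that is, the number of walls on which they disagree. A path of this length exists
  because a minimal halfspace of \<open>u - v\<close> can be replaced in \<open>u\<close> by its complement
  (\<open>flip_ultrafilter\<close>). It follows that \<open>w\<close> lies in the interval between \<open>u\<close> and \<open>v\<close> iff
  \<open>u \<inter> v \<subseteq> w\<close> (\<open>interval_iff\<close>), so the median of three vertices consists of the
  halfspaces lying in at least two of them.

  For uniqueness, intervals detect adjacency, so a median automorphism is a graph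
  automorphism and hence an isometry. If \<open>u\<close> and \<open>w\<close> are adjacent with
  \<open>u - w = {A}\<close>, then \<open>A\<close> is the set of points \<open>x\<close> whose principal ultrafilter is closer
  to \<open>u\<close> than to \<open>w\<close> (\<open>edge_label\<close>). Hence a neighbour of a known vertex is determined by its
  distances to the principal ultrafilters, and an automorphism extending \<open>f\<close> is determined along
  any path starting at a principal ultrafilter (\<open>graph_automorphism_extending\<close>). Uniqueness among
  graph automorphisms, and not only among median ones, is what the statement on actions needs;
  there the maps induced by the group elements compose because images of sets do.
\<close>

section \<open>Graphs with an explicit distance\<close>

text \<open>
  The axioms force \<open>d\<close> to be the path metric of the graph: adjacency and the triangle inequality
  bound \<open>d\<close> by the length of any walk, and the last axiom yields a walk attaining the bound.
\<close>
locale graph_distance = pair_wf_digraph G for G :: "'v pair_pre_digraph" +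
  fixes d :: "'v \<Rightarrow> 'v \<Rightarrow> nat"
  assumes d_zero: "\<lbrakk>u \<in> pverts G; v \<in> pverts G\<rbrakk> \<Longrightarrow> d u v = 0 \<longleftrightarrow> u = v"
    and d_triangle: "\<lbrakk>u \<in> pverts G; v \<in> pverts G; w \<in> pverts G\<rbrakk> \<Longrightarrow> d u w \<le> d u v + d v w"
    and d_adjacent: "\<lbrakk>u \<in> pverts G; v \<in> pverts G\<rbrakk> \<Longrightarrow> (u, v) \<in> parcs G \<longleftrightarrow> d u v = 1"
    and d_step: "\<lbrakk>u \<in> pverts G; v \<in> pverts G; d u v = Suc n\<rbrakk>
      \<Longrightarrow> \<exists>w\<in>pverts G. d u w = 1 \<and> d w v = n"
begin

lemma d_le_length:
  assumes "vwalk p (with_proj G)"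
  shows "d (hd p) (last p) < length p"
  using assms
proof (induction p rule: list.induct)
  case Nil
  then show ?case by (simp add: vwalk_def)
next
  case (Cons a q)
  show ?case
  proof (cases "q = []")
    case True
    with Cons.prems show ?thesis using d_zero by (simp add: vwalk_def)
  next
    case False
    then have arc: "(a, hd q) \<in> parcs G" and q: "vwalk q (with_proj G)"
      using Cons.prems by (auto elim: vwalk_consE)
    have verts: "a \<in> pverts G" "hd q \<in> pverts G" "last q \<in> pverts G"
      using Cons.prems False by (auto simp: vwalk_def)
    have "d a (last q) \<le> d a (hd q) + d (hd q) (last q)"
      using verts d_triangle by blast
    also have "d a (hd q) = 1"
      using d_adjacent verts arc by blast
    finally show ?thesis
      using Cons.IH[OF q] False by simp
  qed
qed

lemma geodesic_exists:
  assumes "u \<in> pverts G" "v \<in> pverts G"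
  shows "\<exists>p. vwalk p (with_proj G) \<and> hd p = u \<and> last p = v \<and> length p = Suc (d u v)"
  using assms
proof (induction "d u v" arbitrary: u)
  case 0
  then have "u = v" using d_zero by metis
  with 0 show ?case by (intro exI[of _ "[u]"]) auto
next
  case (Suc n)
  obtain w where w: "w \<in> pverts G" "d u w = 1" "d w v = n"
    using d_step Suc.prems Suc.hyps(2) by metis
  then obtain p where p: "vwalk p (with_proj G)" "hd p = w" "last p = v" "length p = Suc n"
    using Suc.hyps(1) Suc.prems by metis
  have "(u, w) \<in> parcs G"
    using w Suc.prems d_adjacent by blast
  then have "vwalk (u # p) (with_proj G)"
    using p Suc.prems by (auto intro!: vwalk_consI)
  moreover have "last (u # p) = v" "p \<noteq> []"
    using p by auto
  ultimately show ?case
    using p(4) Suc.hyps(2) by (intro exI[of _ "u # p"]) auto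
qed

text \<open>
  A repeated vertex would allow a shortcut. Walks of length \<open>d\<close> are therefore paths, and
  no walk has to be shortened to a path by hand when walks are concatenated below.
\<close>

lemma geodesic_distinct:
  assumes "vwalk p (with_proj G)" "length p = Suc (d (hd p) (last p))"
  shows "distinct p"
  using assms
proof (induction p rule: list.induct)
  case Nil
  then show ?case by simp
next
  case (Cons a q)
  show ?case
  proof (cases "q = []")
    case False
    then have arc: "(a, hd q) \<in> parcs G" and q: "vwalk q (with_proj G)"
      using Cons.prems by (auto elim: vwalk_consE)
    have verts: "a \<in> pverts G" "hd q \<in> pverts G" "last q \<in> pverts G"
      using Cons.prems False by (auto simp: vwalk_def)
    have "d a (last q) \<le> 1 + d (hd q) (last q)"
      using d_triangle[OF verts] d_adjacent verts arc by simp
    then have len: "length q = Suc (d (hd q) (last q))"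
      using Cons.prems(2) False d_le_length[OF q] by simp
    have "a \<notin> set q"
    proof
      assume "a \<in> set q"
      then obtain xs ys where xy: "q = xs @ a # ys" by (meson split_list)
      then have "vwalk (a # ys) (with_proj G)"
        using q by (auto intro: vwalkI_append_r)
      then have "d a (last q) < Suc (length ys)"
        using d_le_length[of "a # ys"] xy by simp
      with Cons.prems(2) False xy show False by simp
    qed
    with Cons.IH[OF q len] show ?thesis by simp
  qed simp
qed

lemma shortest_vpath_iff:
  assumes "u \<in> pverts G" "v \<in> pverts G"
  shows "shortest_vpath G u p v \<longleftrightarrow>
    vwalk p (with_proj G) \<and> hd p = u \<and> last p = v \<and> length p = Suc (d u v)"
proof
  assume "shortest_vpath G u p v"
  then have p: "vwalk p (with_proj G)" "hd p = u" "last p = v"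
    and shortest: "\<And>q. \<lbrakk>vpath q (with_proj G); hd q = u; last q = v\<rbrakk> \<Longrightarrow> length p - 1 \<le> length q - 1"
    by (auto simp: shortest_vpath_def vpath_def)
  obtain q where q: "vwalk q (with_proj G)" "hd q = u" "last q = v" "length q = Suc (d u v)"
    using geodesic_exists assms by blast
  then have "vpath q (with_proj G)"
    using geodesic_distinct by (auto simp: vpath_def)
  then have "length p - 1 \<le> length q - 1"
    using shortest q by blast
  with q d_le_length[OF p(1)] p
  show "vwalk p (with_proj G) \<and> hd p = u \<and> last p = v \<and> length p = Suc (d u v)"
    by auto
next
  assume p: "vwalk p (with_proj G) \<and> hd p = u \<and> last p = v \<and> length p = Suc (d u v)"
  then have "vpath p (with_proj G)"
    using geodesic_distinct by (auto simp: vpath_def)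
  moreover have "length p - 1 \<le> length q - 1"
    if "vpath q (with_proj G)" "hd q = u" "last q = v" for q
    using d_le_length[of q] that p by (auto simp: vpath_def)
  ultimately show "shortest_vpath G u p v"
    using p by (auto simp: shortest_vpath_def)
qed

text \<open>
  A vertex on a shortest path splits it into two walks, whose lengths bound the two distances;
  conversely, two geodesics joined at \<open>w\<close> form a walk of length \<open>d u v\<close>.
\<close>

lemma interval_eq:
  assumes "u \<in> pverts G" "v \<in> pverts G"
  shows "interval G u v = {w \<in> pverts G. d u w + d w v = d u v}"
proof (intro equalityI subsetI)
  fix w assume "w \<in> interval G u v"
  then have "\<exists>p. (vwalk p (with_proj G) \<and> hd p = u \<and> last p = v \<and> length p = Suc (d u v)) \<and> w \<in> set p"
    unfolding interval_def shortest_vpath_iff[OF assms] mem_Collect_eq .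
  then obtain p where p: "vwalk p (with_proj G)" "hd p = u" "last p = v"
      "length p = Suc (d u v)" "w \<in> set p"
    by metis
  then have w: "w \<in> pverts G" unfolding vwalk_def by auto
  obtain xs ys where xy: "p = xs @ w # ys" using p(5) by (meson split_list)
  have left: "vwalk (xs @ [w]) (with_proj G)"
    by (rule vwalkI_append_l[of _ ys]) (use p(1) xy in simp_all)
  have right: "vwalk (w # ys) (with_proj G)"
    by (rule vwalkI_append_r[of _ xs]) (use p(1) xy in simp_all)
  have "hd (xs @ [w]) = u" using p(2) xy by (cases xs) auto
  then have "d u w < Suc (length xs)" using d_le_length[OF left] by simp
  moreover have "d w v < Suc (length ys)" using d_le_length[OF right] p(3) xy by simp
  ultimately have "d u w + d w v \<le> d u v" using p(4) xy by simp
  with w d_triangle[of u w v] assms show "w \<in> {w \<in> pverts G. d u w + d w v = d u v}" by simp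
next
  fix w assume w: "w \<in> {w \<in> pverts G. d u w + d w v = d u v}"
  obtain p where p: "vwalk p (with_proj G)" "hd p = u" "last p = w" "length p = Suc (d u w)"
    using geodesic_exists assms w by blast
  obtain q where q: "vwalk q (with_proj G)" "hd q = w" "last q = v" "length q = Suc (d w v)"
    using geodesic_exists assms w by blast
  have ne: "p \<noteq> []" "q \<noteq> []" using p q by auto
  then have j: "joinable p q" using p q by auto
  have "vwalk (vwalk_join p q) (with_proj G)"
    using vwalk_joinI_vwalk p q j by blast
  moreover have "hd (vwalk_join p q) = u" "last (vwalk_join p q) = v"
    using j p q vwalk_join_hd vwalk_join_last by metis+
  moreover have "length (vwalk_join p q) = Suc (d u v)"
    using p q w by (simp add: vwalk_join_def)
  ultimately have "shortest_vpath G u (vwalk_join p q) v"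
    using shortest_vpath_iff assms by blast
  moreover have "w \<in> set (vwalk_join p q)"
    using p(3) ne by (auto simp: vwalk_join_def)
  ultimately show "w \<in> interval G u v" by (auto simp: interval_def)
qed

lemma all_reachable:
  assumes "u \<in> pverts G" "v \<in> pverts G"
  shows "reachable (with_proj G) u v"
  using geodesic_exists[OF assms] reachable_vwalk_conv by blast

text \<open>
  Expresses adjacency through intervals alone, which is how a map preserving intervals is seen to
  preserve arcs.
\<close>

lemma adjacent_iff_interval:
  assumes "u \<in> pverts G" "v \<in> pverts G"
  shows "(u, v) \<in> parcs G \<longleftrightarrow> u \<noteq> v \<and> interval G u v = {u, v}"
proof
  assume "(u, v) \<in> parcs G"
  then have d: "d u v = 1" using d_adjacent assms by blast
  then have "u \<noteq> v" using d_zero assms by (metis zero_neq_one)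
  have "w = u \<or> w = v" if "w \<in> pverts G" "d u w + d w v = 1" for w
  proof -
    have "d u w = 0 \<or> d w v = 0" using that(2) by arith
    then show ?thesis using d_zero assms that(1) by blast
  qed
  moreover have "d u u = 0" "d v v = 0" using d_zero assms by auto
  ultimately have "interval G u v = {u, v}"
    unfolding interval_eq[OF assms] d using assms d by auto
  with \<open>u \<noteq> v\<close> show "u \<noteq> v \<and> interval G u v = {u, v}" by simp
next
  assume uv: "u \<noteq> v \<and> interval G u v = {u, v}"
  then obtain n where n: "d u v = Suc n"
    using d_zero assms by (metis not0_implies_Suc)
  then obtain w where w: "w \<in> pverts G" "d u w = 1" "d w v = n"
    using d_step assms by metis
  then have "w \<in> interval G u v"
    unfolding interval_eq[OF assms] using n by simp
  then have "w \<in> {u, v}" using uv by blast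
  moreover have "d u u = 0" using d_zero assms by auto
  ultimately show "(u, v) \<in> parcs G"
    using w d_adjacent assms by auto
qed

lemma median_automorphism_imp_graph_automorphism:
  assumes "median_automorphism G h"
  shows "graph_automorphism G h"
proof -
  let ?V = "pverts G"
  have bij: "bij_betw h ?V ?V"
    and into: "\<And>u v. \<lbrakk>u \<in> ?V; v \<in> ?V\<rbrakk> \<Longrightarrow> h ` interval G u v \<subseteq> interval G (h u) (h v)"
    and into_inv: "\<And>u v. \<lbrakk>u \<in> ?V; v \<in> ?V\<rbrakk> \<Longrightarrow>
      inv_into ?V h ` interval G u v \<subseteq> interval G (inv_into ?V h u) (inv_into ?V h v)"
    using assms by (auto simp: median_automorphism_def median_morphism_def)
  have hV: "h u \<in> ?V" if "u \<in> ?V" for u using bij that by (auto simp: bij_betw_def)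
  have inv: "inv_into ?V h (h u) = u" if "u \<in> ?V" for u
    using bij that by (auto simp: bij_betw_def)
  have h_inv: "h (inv_into ?V h u) = u" if "u \<in> ?V" for u
    using bij that by (auto simp: bij_betw_def intro: f_inv_into_f)
  have sub: "interval G u v \<subseteq> ?V" if "u \<in> ?V" "v \<in> ?V" for u v
    using interval_eq[OF that] by auto
  have image: "h ` interval G u v = interval G (h u) (h v)" if "u \<in> ?V" "v \<in> ?V" for u v
  proof
    show "interval G (h u) (h v) \<subseteq> h ` interval G u v"
    proof
      fix w assume w: "w \<in> interval G (h u) (h v)"
      then have "inv_into ?V h w \<in> interval G u v"
        using into_inv[OF hV hV] that inv by fastforce
      moreover have "w \<in> ?V" using sub[OF hV hV] that w by blast
      ultimately show "w \<in> h ` interval G u v" using h_inv by (metis imageI)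
    qed
  qed (use into that in blast)
  have inj: "inj_on h ?V" using bij by (simp add: bij_betw_def)
  have "(u, v) \<in> parcs G \<longleftrightarrow> (h u, h v) \<in> parcs G" if uv: "u \<in> ?V" "v \<in> ?V" for u v
  proof -
    have "h ` interval G u v = h ` {u, v} \<longleftrightarrow> interval G u v = {u, v}"
      by (rule inj_on_image_eq_iff[OF inj sub[OF uv]]) (use uv in simp)
    then have "interval G (h u) (h v) = {h u, h v} \<longleftrightarrow> interval G u v = {u, v}"
      unfolding image[OF uv] by simp
    moreover have "h u = h v \<longleftrightarrow> u = v"
      using inj uv by (rule inj_on_eq_iff)
    ultimately show ?thesis
      unfolding adjacent_iff_interval[OF uv] adjacent_iff_interval[OF hV[OF uv(1)] hV[OF uv(2)]]
      by blast
  qed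
  with bij show ?thesis by (auto simp: graph_automorphism_def)
qed

lemma graph_automorphism_inv:
  assumes "graph_automorphism G h"
  shows "graph_automorphism G (inv_into (pverts G) h)"
proof -
  let ?V = "pverts G" and ?k = "inv_into (pverts G) h"
  have bij: "bij_betw h ?V ?V" using assms by (simp add: graph_automorphism_def)
  have k: "bij_betw ?k ?V ?V" using bij by (rule bij_betw_inv_into)
  have h_k: "h (?k u) = u" if "u \<in> ?V" for u
    using bij that by (auto simp: bij_betw_def intro: f_inv_into_f)
  have kV: "?k u \<in> ?V" if "u \<in> ?V" for u using k that by (auto simp: bij_betw_def)
  show ?thesis
    using assms k h_k kV unfolding graph_automorphism_def by metis
qed

text \<open>
  Induction along a geodesic; the isometry below follows by applying this bound to the inverse
  automorphism as well.
\<close>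

lemma graph_automorphism_d_le:
  assumes "graph_automorphism G h" "u \<in> pverts G" "v \<in> pverts G"
  shows "d (h u) (h v) \<le> d u v"
  using assms(2,3)
proof (induction "d u v" arbitrary: u)
  case 0
  then have "u = v" using d_zero by metis
  moreover have "h v \<in> pverts G"
    using assms(1) 0 by (auto simp: graph_automorphism_def bij_betw_def)
  ultimately show ?case using d_zero[of "h v" "h v"] by simp
next
  case (Suc n)
  have hV: "h x \<in> pverts G" if "x \<in> pverts G" for x
    using assms(1) that by (auto simp: graph_automorphism_def bij_betw_def)
  obtain w where w: "w \<in> pverts G" "d u w = 1" "d w v = n"
    using d_step Suc.prems Suc.hyps(2) by metis
  then have "(h u, h w) \<in> parcs G"
    using assms(1) d_adjacent Suc.prems by (auto simp: graph_automorphism_def)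
  then have "d (h u) (h w) = 1"
    using d_adjacent hV w Suc.prems by blast
  moreover have "d (h w) (h v) \<le> n"
    using Suc.hyps(1)[of w] w Suc.prems by simp
  ultimately show ?case
    using d_triangle[of "h u" "h w" "h v"] hV w Suc.prems Suc.hyps(2) by simp
qed

lemma graph_automorphism_isometry:
  assumes "graph_automorphism G h" "u \<in> pverts G" "v \<in> pverts G"
  shows "d (h u) (h v) = d u v"
proof (rule antisym)
  let ?k = "inv_into (pverts G) h"
  have bij: "bij_betw h (pverts G) (pverts G)" using assms by (simp add: graph_automorphism_def)
  have "h u \<in> pverts G" "h v \<in> pverts G" using bij assms by (auto simp: bij_betw_def)
  then have "d (?k (h u)) (?k (h v)) \<le> d (h u) (h v)"
    using graph_automorphism_d_le[OF graph_automorphism_inv[OF assms(1)]] by blast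
  then show "d u v \<le> d (h u) (h v)"
    using bij assms by (auto simp: bij_betw_def)
qed (rule graph_automorphism_d_le[OF assms])

lemma graph_automorphism_median_morphism:
  assumes "median_graph G" "graph_automorphism G h"
  shows "median_morphism G G h"
proof -
  have hV: "h x \<in> pverts G" if "x \<in> pverts G" for x
    using assms(2) that by (auto simp: graph_automorphism_def bij_betw_def)
  have "h ` interval G u v \<subseteq> interval G (h u) (h v)"
    if uv: "u \<in> pverts G" "v \<in> pverts G" for u v
  proof
    fix y assume "y \<in> h ` interval G u v"
    then obtain w where w: "y = h w" "w \<in> pverts G" "d u w + d w v = d u v"
      unfolding interval_eq[OF uv] by blast
    then have "d (h u) y + d y (h v) = d (h u) (h v)"
      using graph_automorphism_isometry[OF assms(2)] uv by simp
    then show "y \<in> interval G (h u) (h v)"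
      unfolding interval_eq[OF hV[OF uv(1)] hV[OF uv(2)]] using w hV by simp
  qed
  with hV assms(1) show ?thesis by (auto simp: median_morphism_def)
qed

lemma graph_automorphism_imp_median_automorphism:
  assumes "median_graph G" "graph_automorphism G h"
  shows "median_automorphism G h"
proof -
  have "bij_betw h (pverts G) (pverts G)"
    using assms(2) by (simp add: graph_automorphism_def)
  then show ?thesis
    unfolding median_automorphism_def
    using assms graph_automorphism_median_morphism graph_automorphism_inv by blast
qed

end


section \<open>Ultrafilters of halfspaces\<close>

context space_with_walls
begin

lemma halfspaceE:
  assumes "A \<in> halfspaces W"
  obtains "A \<subseteq> X" "{A, X - A} \<in> W"
proof -
  obtain w where w: "w \<in> W" "A \<in> w"
    using assms by (auto simp: halfspaces_def)
  then obtain B where B: "B \<subseteq> X" "w = {B, X - B}"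
    using walls unfolding is_wall_def by blast
  then have "A = B \<or> A = X - B" using w by blast
  then show thesis
  proof
    assume "A = B"
    then show thesis using that w B by blast
  next
    assume A: "A = X - B"
    then have "X - A = B" using B(1) by blast
    then have "w = {A, X - A}" using A B(2) by blast
    then show thesis using that A w(1) by blast
  qed
qed

lemma halfspace_subset: "A \<in> halfspaces W \<Longrightarrow> A \<subseteq> X"
  by (elim halfspaceE)

lemma halfspace_compl: "A \<in> halfspaces W \<Longrightarrow> X - A \<in> halfspaces W"
  by (elim halfspaceE) (auto simp: halfspaces_def)

lemma X_halfspace: "X \<in> halfspaces W"
  using trivial_wall by (auto simp: halfspaces_def)

lemma compl_compl: "A \<in> halfspaces W \<Longrightarrow> X - (X - A) = A"
  using halfspace_subset by blast

lemma wall_ultrafilterI: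
  assumes "u \<noteq> {}" "u \<subseteq> halfspaces W"
    and "\<And>A B. \<lbrakk>A \<in> u; B \<in> halfspaces W; A \<subseteq> B\<rbrakk> \<Longrightarrow> B \<in> u"
    and "\<And>A. A \<in> halfspaces W \<Longrightarrow> X - A \<in> u \<longleftrightarrow> A \<notin> u"
  shows "wall_ultrafilter X W u"
  unfolding wall_ultrafilter_def using assms by simp

lemma ultrafilter_halfspace: "\<lbrakk>wall_ultrafilter X W u; A \<in> u\<rbrakk> \<Longrightarrow> A \<in> halfspaces W"
  by (auto simp: wall_ultrafilter_def)

lemma ultrafilter_up:
  "\<lbrakk>wall_ultrafilter X W u; A \<in> u; B \<in> halfspaces W; A \<subseteq> B\<rbrakk> \<Longrightarrow> B \<in> u"
  by (auto simp: wall_ultrafilter_def)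

lemma ultrafilter_compl:
  "\<lbrakk>wall_ultrafilter X W u; A \<in> halfspaces W\<rbrakk> \<Longrightarrow> X - A \<in> u \<longleftrightarrow> A \<notin> u"
  by (auto simp: wall_ultrafilter_def)

lemma X_in_ultrafilter: "wall_ultrafilter X W u \<Longrightarrow> X \<in> u"
  using X_halfspace halfspace_subset unfolding wall_ultrafilter_def by blast

text \<open>
  An ultrafilter picks exactly one side of each wall, so it is maximal. This is why it suffices to
  test one inclusion throughout.
\<close>

lemma ultrafilter_subset_eq:
  assumes "wall_ultrafilter X W u" "wall_ultrafilter X W v" "u \<subseteq> v"
  shows "u = v"
  using assms ultrafilter_compl ultrafilter_halfspace by blast

text \<open>
  On each wall where \<open>u\<close> and \<open>v\<close> disagree, they pick complementary sides. Hence the symmetric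
  difference is twice as large as \<open>u - v\<close>, which cancels the factor one half in the definition of
  adjacency.
\<close>

lemma ultrafilter_diff_swap:
  assumes "wall_ultrafilter X W u" "wall_ultrafilter X W v"
  shows "v - u = (\<lambda>A. X - A) ` (u - v)"
proof (intro equalityI subsetI)
  fix A assume A: "A \<in> v - u"
  then have H: "A \<in> halfspaces W" using assms(2) ultrafilter_halfspace by blast
  then have "X - A \<in> u - v" using A assms ultrafilter_compl by blast
  then show "A \<in> (\<lambda>A. X - A) ` (u - v)" using compl_compl[OF H] by (metis imageI)
next
  fix B assume "B \<in> (\<lambda>A. X - A) ` (u - v)"
  then obtain A where A: "B = X - A" "A \<in> u" "A \<notin> v" by blast
  moreover have "A \<in> halfspaces W" using A assms(1) ultrafilter_halfspace by blast
  ultimately show "B \<in> v - u" using assms ultrafilter_compl by blast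
qed

lemma inj_compl: "inj_on (\<lambda>A. X - A) (halfspaces W)"
  using compl_compl by (metis inj_onI)

lemma card_diff_commute:
  assumes "wall_ultrafilter X W u" "wall_ultrafilter X W v"
  shows "card (v - u) = card (u - v)"
proof -
  have "inj_on (\<lambda>A. X - A) (u - v)"
    using assms ultrafilter_halfspace by (intro inj_on_subset[OF inj_compl]) blast
  then show ?thesis
    unfolding ultrafilter_diff_swap[OF assms] by (rule card_image)
qed

lemma principal_ultrafilter:
  assumes "x \<in> X"
  shows "wall_ultrafilter X W (principal W x)"
  unfolding wall_ultrafilter_def principal_def
  using assms X_halfspace halfspace_compl by blast

text \<open>
  A halfspace containing \<open>x\<close> but not \<open>y\<close> belongs to a wall separating them, and there are
  finitely many such walls.
\<close>

lemma finite_principal_diff: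
  assumes "x \<in> X" "y \<in> X"
  shows "finite (principal W x - principal W y)"
proof (cases "x = y")
  case False
  have "principal W x - principal W y \<subseteq> \<Union>{w \<in> W. separates w x y}"
  proof
    fix A assume "A \<in> principal W x - principal W y"
    then obtain w where w: "w \<in> W" "A \<in> w" "x \<in> A" "y \<notin> A"
      by (auto simp: principal_def halfspaces_def)
    then obtain B where B: "B \<subseteq> X" "w = {B, X - B}"
      using walls by (auto simp: is_wall_def)
    have "\<exists>C\<in>w. y \<in> C" using B assms by blast
    then have "separates w x y" using w unfolding separates_def by metis
    with w show "A \<in> \<Union>{w \<in> W. separates w x y}" by blast
  qed
  moreover have "finite w" if "w \<in> W" for w
    using walls[OF that] by (auto simp: is_wall_def)
  then have "finite (\<Union>{w \<in> W. separates w x y})"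
    using finite_separating[OF assms False] by (intro finite_Union) simp_all
  ultimately show ?thesis by (rule finite_subset)
qed simp

section \<open>The distance of the graph of almost principal ultrafilters\<close>

abbreviation vertices :: "'a set set set" where
  "vertices \<equiv> pverts (C1 X W)"

lemma vertex_ultrafilter: "u \<in> vertices \<Longrightarrow> wall_ultrafilter X W u"
  by (simp add: C1_def almost_principal_def)

lemma principal_vertex: "x \<in> X \<Longrightarrow> principal W x \<in> vertices"
  using principal_ultrafilter by (auto simp: C1_def almost_principal_def intro!: bexI[of _ x])

lemma finite_vertex_diff:
  assumes "u \<in> vertices" "v \<in> vertices"
  shows "finite (u - v)"
proof -
  obtain x y where xy: "x \<in> X" "finite (sym_diff u (principal W x))"
      "y \<in> X" "finite (sym_diff v (principal W y))"
    using assms by (auto simp: C1_def almost_principal_def)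
  have "u - v \<subseteq> sym_diff u (principal W x) \<union> (principal W x - principal W y)
      \<union> sym_diff v (principal W y)"
    by blast
  then show ?thesis
    using xy finite_principal_diff by (meson finite_UnI finite_subset)
qed

lemma vertex_if_finite_diff:
  assumes "wall_ultrafilter X W w" "u \<in> vertices" "finite (w - u)"
  shows "w \<in> vertices"
proof -
  obtain x where x: "x \<in> X" "finite (sym_diff u (principal W x))"
    using assms by (auto simp: C1_def almost_principal_def)
  have "finite (u - w)"
    using ultrafilter_diff_swap[OF assms(1) vertex_ultrafilter[OF assms(2)]] assms(3) by simp
  moreover have "sym_diff w (principal W x) \<subseteq> sym_diff u (principal W x) \<union> (w - u) \<union> (u - w)"
    by blast
  ultimately have "finite (sym_diff w (principal W x))"
    using x assms(3) by (meson finite_UnI finite_subset)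
  with x assms(1) show ?thesis by (auto simp: C1_def almost_principal_def)
qed

lemma arc_iff:
  "(u, v) \<in> parcs (C1 X W) \<longleftrightarrow> u \<in> vertices \<and> v \<in> vertices \<and> card (u - v) = 1"
proof (cases "u \<in> vertices \<and> v \<in> vertices")
  case True
  then have "finite (u - v)" "finite (v - u)" using finite_vertex_diff by auto
  then have "card (sym_diff u v) = card (u - v) + card (v - u)"
    by (intro card_Un_disjoint) auto
  also have "\<dots> = 2 * card (u - v)"
    using card_diff_commute True vertex_ultrafilter by simp
  finally show ?thesis using True by (simp add: C1_def)
qed (auto simp: C1_def)

text \<open>
  Crossing the wall of \<open>A\<close>. Minimality of \<open>A\<close> makes the result upward closed: a halfspace of
  \<open>u\<close> strictly inside \<open>A\<close> would lie in \<open>v\<close> and force \<open>A \<in> v\<close>; and if some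
  \<open>C \<supset> X - A\<close> were not in \<open>u\<close>, then \<open>X - C\<close> would be a smaller element of \<open>u - v\<close>.
\<close>

lemma flip_ultrafilter:
  assumes u: "wall_ultrafilter X W u" and v: "wall_ultrafilter X W v"
    and A: "A \<in> u - v" and minimal: "\<And>B. \<lbrakk>B \<in> u - v; B \<subseteq> A\<rbrakk> \<Longrightarrow> B = A"
  shows "wall_ultrafilter X W (insert (X - A) (u - {A}))"
proof -
  let ?w = "insert (X - A) (u - {A})"
  have HA: "A \<in> halfspaces W" using A u ultrafilter_halfspace by blast
  have notX: "A \<noteq> X" using A X_in_ultrafilter[OF v] by blast
  have ne: "X - A \<noteq> A" using HA halfspace_subset A u ultrafilter_compl by metis
  have up: "C \<in> ?w" if B: "B \<in> ?w" and C: "C \<in> halfspaces W" and BC: "B \<subseteq> C" for B C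
  proof (cases "B = X - A")
    case True
    have "C \<noteq> A" using True BC notX halfspace_subset[OF HA] by blast
    moreover have "C \<in> u" if "C \<noteq> X - A"
    proof (rule ccontr)
      assume "C \<notin> u"
      then have "X - C \<in> u" using ultrafilter_compl u C by blast
      moreover have "C \<in> v"
        using A HA BC True C ultrafilter_compl[OF v HA] ultrafilter_up[OF v] by blast
      then have "X - C \<notin> v" using ultrafilter_compl v C by blast
      moreover have "X - C \<subseteq> A" using BC True by blast
      ultimately have "X - C = A" using minimal by blast
      then show False using that compl_compl[OF C] by blast
    qed
    ultimately show ?thesis by blast
  next
    case False
    then have B: "B \<in> u" "B \<noteq> A" using B by auto
    have "C \<noteq> A"
    proof
      assume "C = A"
      then have "B \<in> v" using minimal B BC by blast
      then show False using ultrafilter_up[OF v _ C BC] A \<open>C = A\<close> by blast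
    qed
    then show ?thesis using ultrafilter_up[OF u B(1) C BC] by blast
  qed
  have compl: "X - C \<in> ?w \<longleftrightarrow> C \<notin> ?w" if C: "C \<in> halfspaces W" for C
  proof -
    have "X - C = A \<longleftrightarrow> C = X - A" "X - C = X - A \<longleftrightarrow> C = A"
      using compl_compl[OF C] compl_compl[OF HA] by auto
    then show ?thesis using ultrafilter_compl[OF u C] ne A by auto
  qed
  have sub: "?w \<subseteq> halfspaces W"
    using u HA halfspace_compl by (auto simp: wall_ultrafilter_def)
  show ?thesis
    by (rule wall_ultrafilterI[OF _ sub up compl]) auto
qed

lemma vertex_step:
  assumes uv: "u \<in> vertices" "v \<in> vertices" and n: "card (u - v) = Suc n"
  shows "\<exists>w\<in>vertices. card (u - w) = 1 \<and> card (w - v) = n"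
proof -
  have fin: "finite (u - v)" using finite_vertex_diff uv by blast
  have u: "wall_ultrafilter X W u" and v: "wall_ultrafilter X W v"
    using uv vertex_ultrafilter by auto
  have "u - v \<noteq> {}" using n by (metis card.empty nat.distinct(1))
  then obtain A where A: "A \<in> u - v" and minimal: "\<And>B. \<lbrakk>B \<in> u - v; B \<subseteq> A\<rbrakk> \<Longrightarrow> B = A"
    using finite_has_minimal[OF fin] by metis
  let ?w = "insert (X - A) (u - {A})"
  have w: "wall_ultrafilter X W ?w"
    using flip_ultrafilter[OF u v A minimal] .
  have HA: "A \<in> halfspaces W" using A u ultrafilter_halfspace by blast
  have "X - A \<notin> u" "X - A \<in> v" using A HA ultrafilter_compl u v by auto
  then have diffs: "u - ?w = {A}" "?w - v = (u - v) - {A}" "?w - u = {X - A}" 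
    using A by auto
  have "?w \<in> vertices"
    using vertex_if_finite_diff[OF w uv(1)] diffs(3) by simp
  moreover have "card (u - ?w) = 1" using diffs(1) by simp
  moreover have "card (?w - v) = n" unfolding diffs(2) using A fin n by simp
  ultimately show ?thesis by blast
qed

lemma C1_distance: "graph_distance (C1 X W) (\<lambda>u v. card (u - v))"
proof
  fix e assume "e \<in> parcs (C1 X W)"
  then show "fst e \<in> vertices" "snd e \<in> vertices"
    using arc_iff[of "fst e" "snd e"] by auto
next
  fix u v assume uv: "u \<in> vertices" "v \<in> vertices"
  then show "card (u - v) = 0 \<longleftrightarrow> u = v"
    using finite_vertex_diff[OF uv] ultrafilter_subset_eq[of u v] vertex_ultrafilter by auto
  show "(u, v) \<in> parcs (C1 X W) \<longleftrightarrow> card (u - v) = 1"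
    using arc_iff uv by blast
  fix w assume w: "w \<in> vertices"
  have "card (u - w) \<le> card ((u - v) \<union> (v - w))"
    using finite_vertex_diff uv w by (intro card_mono) auto
  also have "\<dots> \<le> card (u - v) + card (v - w)" by (rule card_Un_le)
  finally show "card (u - w) \<le> card (u - v) + card (v - w)" .
next
  fix u v n assume "u \<in> vertices" "v \<in> vertices" "card (u - v) = Suc n"
  then show "\<exists>w\<in>vertices. card (u - w) = 1 \<and> card (w - v) = n"
    by (rule vertex_step)
qed

interpretation C1: graph_distance "C1 X W" "\<lambda>u v. card (u - v)"
  by (rule C1_distance)


section \<open>Medians\<close>

text \<open>
  \<open>u - v\<close> is always contained in \<open>(u - w) \<union> (w - v)\<close>, so the cardinalities add up exactly
  when this union is disjoint and not larger, i.e. when \<open>w\<close> agrees with \<open>u\<close> and \<open>v\<close> on every wall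
  where these two agree.
\<close>

lemma interval_iff:
  assumes "u \<in> vertices" "v \<in> vertices"
  shows "w \<in> interval (C1 X W) u v \<longleftrightarrow> w \<in> vertices \<and> u \<inter> v \<subseteq> w"
proof -
  have "card (u - w) + card (w - v) = card (u - v) \<longleftrightarrow> u \<inter> v \<subseteq> w" if w: "w \<in> vertices"
  proof
    assume eq: "card (u - w) + card (w - v) = card (u - v)"
    have fin: "finite ((u - w) \<union> (w - v))"
      using finite_vertex_diff assms w by blast
    have "card ((u - w) \<union> (w - v)) \<le> card (u - v)"
      using card_Un_le[of "u - w" "w - v"] eq by simp
    then have "u - v = (u - w) \<union> (w - v)"
      using card_seteq[OF fin, of "u - v"] by blast
    then show "u \<inter> v \<subseteq> w" by blast
  next
    assume sub: "u \<inter> v \<subseteq> w"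
    have "w \<subseteq> u \<union> v"
    proof
      fix B assume B: "B \<in> w"
      then have H: "B \<in> halfspaces W" using vertex_ultrafilter w ultrafilter_halfspace by blast
      then have "X - B \<notin> w" using B ultrafilter_compl vertex_ultrafilter w by blast
      then have "X - B \<notin> u \<inter> v" using sub by blast
      then show "B \<in> u \<union> v" using H ultrafilter_compl vertex_ultrafilter assms by blast
    qed
    with sub have "u - v = (u - w) \<union> (w - v)" by blast
    moreover have "card ((u - w) \<union> (w - v)) = card (u - w) + card (w - v)"
      using finite_vertex_diff assms w by (intro card_Un_disjoint) auto
    ultimately show "card (u - w) + card (w - v) = card (u - v)" by simp
  qed
  then show ?thesis using C1.interval_eq[OF assms] by auto
qed

lemma majority_vertex:
  assumes "u \<in> vertices" "v \<in> vertices" "w \<in> vertices"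
  shows "(u \<inter> v) \<union> (v \<inter> w) \<union> (w \<inter> u) \<in> vertices" (is "?m \<in> _")
proof -
  note uf = assms[THEN vertex_ultrafilter]
  have ne: "?m \<noteq> {}" using uf X_in_ultrafilter by blast
  have sub: "?m \<subseteq> halfspaces W" using uf ultrafilter_halfspace by blast
  have up: "B \<in> ?m" if "A \<in> ?m" "B \<in> halfspaces W" "A \<subseteq> B" for A B
    using that uf ultrafilter_up by blast
  have compl: "X - A \<in> ?m \<longleftrightarrow> A \<notin> ?m" if "A \<in> halfspaces W" for A
    using uf[THEN ultrafilter_compl, OF that] by blast
  have m: "wall_ultrafilter X W ?m"
    using ne sub up compl by (rule wall_ultrafilterI)
  have "?m - u \<subseteq> v - u" by blast
  then show ?thesis
    using vertex_if_finite_diff[OF m assms(1)] finite_vertex_diff assms finite_subset by blast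
qed

lemma C1_median_graph: "median_graph (C1 X W)"
proof -
  have "sym (parcs (C1 X W))"
    using card_diff_commute vertex_ultrafilter by (auto simp: sym_def arc_iff)
  then have "pair_bidirected_digraph (C1 X W)"
    by unfold_locales (auto simp: symmetric_def arc_iff)
  moreover have "\<exists>!m. m \<in> interval (C1 X W) u v \<inter> interval (C1 X W) v w \<inter> interval (C1 X W) w u"
    if uvw: "u \<in> vertices" "v \<in> vertices" "w \<in> vertices" for u v w
  proof -
    let ?m = "(u \<inter> v) \<union> (v \<inter> w) \<union> (w \<inter> u)"
    have m: "?m \<in> vertices" using majority_vertex uvw by blast
    have iff: "z \<in> interval (C1 X W) u v \<inter> interval (C1 X W) v w \<inter> interval (C1 X W) w u
        \<longleftrightarrow> z \<in> vertices \<and> ?m \<subseteq> z" for z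
      using uvw by (auto simp: interval_iff)
    show ?thesis
      unfolding iff using m ultrafilter_subset_eq vertex_ultrafilter by blast
  qed
  ultimately show ?thesis
    using C1.all_reachable by (auto simp: median_graph_def)
qed


section \<open>The map induced by an automorphism\<close>

lemma automorphism_bij: "wall_automorphism X W f \<Longrightarrow> bij_betw f X X"
  by (simp add: wall_automorphism_def)

lemma automorphism_inv:
  assumes "wall_automorphism X W f"
  shows "wall_automorphism X W (inv_into X f)"
proof -
  have bij: "bij_betw f X X" using assms by (rule automorphism_bij)
  have eq: "inv_into X (inv_into X f) x = f x" if "x \<in> X" for x
    using inv_into_inv_into_eq[OF bij that] .
  have "inv_into X (inv_into X f) -` A \<inter> X = f -` A \<inter> X" for A
    using eq by auto
  moreover have "inv_into X (inv_into X f) \<in> X \<rightarrow> X"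
    using eq bij by (auto simp: bij_betw_def)
  ultimately show ?thesis
    using assms bij_betw_inv_into[OF bij]
    by (simp add: wall_automorphism_def wall_morphism_def)
qed

lemma automorphism_image_halfspace:
  assumes "wall_automorphism X W f" "A \<in> halfspaces W"
  shows "f ` A \<in> halfspaces W"
proof -
  have bij: "bij_betw f X X" using assms(1) by (rule automorphism_bij)
  have A: "A \<subseteq> X" using assms halfspace_subset by blast
  have "inv_into X f -` A \<inter> X = f ` A"
  proof (intro equalityI subsetI)
    fix y assume "y \<in> inv_into X f -` A \<inter> X"
    then show "y \<in> f ` A"
      using bij bij_betw_inv_into_right[OF bij, of y] by (auto simp: image_iff intro!: bexI)
  next
    fix y assume "y \<in> f ` A"
    then show "y \<in> inv_into X f -` A \<inter> X"
      using bij A by (auto simp: bij_betw_def subset_iff)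
  qed
  then show ?thesis
    using assms by (auto simp: wall_automorphism_def wall_morphism_def)
qed

lemma automorphism_image_inv:
  assumes "wall_automorphism X W f" "A \<in> halfspaces W"
  shows "inv_into X f ` f ` A = A" "f ` inv_into X f ` A = A"
  using automorphism_bij[OF assms(1)] halfspace_subset[OF assms(2)]
  by (auto simp: bij_betw_def inv_into_image_cancel image_inv_into_cancel)

lemma image_inv:
  assumes "wall_automorphism X W f" "u \<subseteq> halfspaces W"
  shows "image (inv_into X f) ` image f ` u = u" "image f ` image (inv_into X f) ` u = u"
  using automorphism_image_inv[OF assms(1)] assms(2) by (force simp: image_image subset_iff)+

text \<open>
  Membership in the image of \<open>u\<close> is membership of the preimage in \<open>u\<close>, and taking preimages
  preserves inclusions, complements and halfspaces.
\<close>

lemma image_ultrafilter: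
  assumes f: "wall_automorphism X W f" and u: "wall_ultrafilter X W u"
  shows "wall_ultrafilter X W (image f ` u)"
proof -
  let ?g = "inv_into X f"
  have bij: "bij_betw f X X" using f by (rule automorphism_bij)
  have mem: "B \<in> image f ` u \<longleftrightarrow> ?g ` B \<in> u" if B: "B \<in> halfspaces W" for B
  proof
    assume "B \<in> image f ` u"
    then show "?g ` B \<in> u"
      using automorphism_image_inv(1)[OF f] ultrafilter_halfspace[OF u] by auto
  next
    assume "?g ` B \<in> u"
    then show "B \<in> image f ` u"
      using automorphism_image_inv(2)[OF f B] by (metis imageI)
  qed
  have g: "wall_automorphism X W ?g" using f by (rule automorphism_inv)
  have gH: "?g ` B \<in> halfspaces W" if "B \<in> halfspaces W" for B
    using automorphism_image_halfspace[OF g that] .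
  have sub: "image f ` u \<subseteq> halfspaces W"
    using automorphism_image_halfspace[OF f] ultrafilter_halfspace[OF u] by blast
  have up: "B \<in> image f ` u" if "A \<in> image f ` u" "B \<in> halfspaces W" "A \<subseteq> B" for A B
  proof -
    have "?g ` A \<in> u" using mem that sub by blast
    then have "?g ` B \<in> u" using ultrafilter_up[OF u _ gH] that by blast
    then show ?thesis using mem that by blast
  qed
  have compl: "X - B \<in> image f ` u \<longleftrightarrow> B \<notin> image f ` u" if B: "B \<in> halfspaces W" for B
  proof -
    have "?g ` (X - B) = X - ?g ` B"
      using bij_betw_inv_into[OF bij] halfspace_subset[OF B]
      by (simp add: bij_betw_def inj_on_image_set_diff[of _ X])
    then show ?thesis
      using mem[OF B] mem[OF halfspace_compl[OF B]] ultrafilter_compl[OF u gH[OF B]] by simp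
  qed
  have "image f ` u \<noteq> {}" using u by (auto simp: wall_ultrafilter_def)
  then show ?thesis
    using sub up compl by (rule wall_ultrafilterI)
qed

lemma image_principal:
  assumes f: "wall_automorphism X W f" and x: "x \<in> X"
  shows "image f ` principal W x = principal W (f x)"
proof (rule ultrafilter_subset_eq)
  have "f x \<in> X" using automorphism_bij[OF f] x by (auto simp: bij_betw_def)
  then show "wall_ultrafilter X W (principal W (f x))" by (rule principal_ultrafilter)
  show "wall_ultrafilter X W (image f ` principal W x)"
    using image_ultrafilter[OF f] principal_ultrafilter[OF x] .
  show "image f ` principal W x \<subseteq> principal W (f x)"
    using automorphism_image_halfspace[OF f] by (auto simp: principal_def)
qed

lemma image_diff:
  assumes f: "wall_automorphism X W f" and u: "u \<in> vertices" and v: "v \<in> vertices"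
  shows "card (image f ` u - image f ` v) = card (u - v)"
proof -
  have inj: "inj_on (image f) (halfspaces W)"
    using automorphism_image_inv(1)[OF f] by (metis inj_onI)
  have sub: "u - v \<subseteq> halfspaces W" "v \<subseteq> halfspaces W"
    using u v vertex_ultrafilter ultrafilter_halfspace by blast+
  have "inj_on (image f) (u - v)" using inj sub(1) by (rule inj_on_subset)
  then show ?thesis
    unfolding inj_on_image_set_diff[OF inj sub, symmetric] by (rule card_image)
qed

lemma image_vertex:
  assumes f: "wall_automorphism X W f" and u: "u \<in> vertices"
  shows "image f ` u \<in> vertices"
proof -
  obtain x where x: "x \<in> X" "finite (sym_diff u (principal W x))"
    using u by (auto simp: C1_def almost_principal_def)
  have fx: "f x \<in> X" using automorphism_bij[OF f] x by (auto simp: bij_betw_def)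
  have "image f ` u - principal W (f x) \<subseteq> image f ` (u - principal W x)"
    unfolding image_principal[OF f x(1), symmetric] by blast
  then have "finite (image f ` u - principal W (f x))"
    using finite_vertex_diff[OF u principal_vertex[OF x(1)]] finite_subset by blast
  then show ?thesis
    using vertex_if_finite_diff image_ultrafilter[OF f] vertex_ultrafilter[OF u]
      principal_vertex[OF fx] by blast
qed

lemma image_graph_automorphism:
  assumes f: "wall_automorphism X W f"
  shows "graph_automorphism (C1 X W) (\<lambda>u\<in>vertices. image f ` u)"
proof -
  let ?h = "\<lambda>u\<in>vertices. image f ` u" and ?k = "\<lambda>u. image (inv_into X f) ` u"
  have sub: "u \<subseteq> halfspaces W" if "u \<in> vertices" for u
    using that vertex_ultrafilter ultrafilter_halfspace by blast
  have "bij_betw ?h vertices vertices"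
  proof (rule bij_betw_byWitness[where f' = ?k])
    show "\<forall>u\<in>vertices. ?k (?h u) = u" using image_inv(1)[OF f sub] by simp
    show "\<forall>u\<in>vertices. ?h (?k u) = u"
      using image_inv(2)[OF f sub] image_vertex[OF automorphism_inv[OF f]] by simp
    show "?h ` vertices \<subseteq> vertices" using image_vertex[OF f] by auto
    show "?k ` vertices \<subseteq> vertices" using image_vertex[OF automorphism_inv[OF f]] by auto
  qed
  then show ?thesis
    using image_vertex[OF f] image_diff[OF f] by (simp add: graph_automorphism_def arc_iff)
qed

lemma image_extends:
  assumes "wall_automorphism X W f"
  shows "extends_to_C1 X W f (\<lambda>u\<in>vertices. image f ` u)"
  using assms image_principal principal_vertex by (simp add: extends_to_C1_def)


section \<open>Uniqueness of the extension\<close>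

text \<open>
  Both ultrafilters pick the same side of every wall except the one of \<open>A\<close>, and the principal
  ultrafilter of \<open>x\<close> sides with \<open>u\<close> there iff \<open>x \<in> A\<close>.
\<close>

lemma edge_label:
  assumes u: "u \<in> vertices" and w: "w \<in> vertices" and A: "u - w = {A}"
  shows "A = {x \<in> X. card (u - principal W x) < card (w - principal W x)}"
proof -
  have HA: "A \<in> halfspaces W" using A u vertex_ultrafilter ultrafilter_halfspace by blast
  have wu: "w - u = {X - A}"
    using ultrafilter_diff_swap[of u w] u w vertex_ultrafilter A by simp
  have "x \<in> A \<longleftrightarrow> card (u - principal W x) < card (w - principal W x)" if x: "x \<in> X" for x
  proof (cases "x \<in> A")
    case True
    then have "u - principal W x = (w - principal W x) - {X - A}" "X - A \<in> w - principal W x"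
      using A wu HA by (auto simp: principal_def)
    then have "card (u - principal W x) < card (w - principal W x)"
      using finite_vertex_diff[OF w principal_vertex[OF x]] by (metis card_Diff1_less)
    with True show ?thesis by simp
  next
    case False
    have "X - A \<in> principal W x" using False x HA halfspace_compl by (simp add: principal_def)
    moreover have "w = insert (X - A) (u - {A})" using A wu by blast
    ultimately have "w - principal W x = (u - {A}) - principal W x" by simp
    then have "w - principal W x = (u - principal W x) - {A}" by (metis Diff_insert Diff_insert2)
    then have "card (w - principal W x) \<le> card (u - principal W x)"
      using card_Diff1_le by metis
    with False show ?thesis by simp
  qed
  then show ?thesis using halfspace_subset[OF HA] by (intro equalityI subsetI) auto
qed

text \<open>
  The common neighbour \<open>w\<close> is essential: distances to the principal ultrafilters alone do not
  separate vertices. For example, let \<open>X\<close> be the six two-element subsets of \<open>{1, 2, 3, 4}\<close>, with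
  a nontrivial wall \<open>{A\<^sub>i, X - A\<^sub>i}\<close> for each \<open>i\<close>, where \<open>A\<^sub>i\<close> consists of the pairs
  containing \<open>i\<close>. The ultrafilter containing all \<open>A\<^sub>i\<close> and the one containing all their
  complements both have distance 2 to every principal ultrafilter.
\<close>

lemma neighbour_eqI:
  assumes V: "u \<in> vertices" "v \<in> vertices" "w \<in> vertices"
    and adj: "card (u - w) = 1" "card (v - w) = 1"
    and dist: "\<And>x. x \<in> X \<Longrightarrow> card (u - principal W x) = card (v - principal W x)"
  shows "u = v"
proof -
  obtain A where A: "u - w = {A}" using adj(1) by (rule card_1_singletonE)
  obtain B where B: "v - w = {B}" using adj(2) by (rule card_1_singletonE)
  have "A = B"
    unfolding edge_label[OF V(1,3) A] edge_label[OF V(2,3) B] using dist by auto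
  then have "u - w = v - w" using A B by simp
  then have "w - u = w - v"
    using ultrafilter_diff_swap[of u w] ultrafilter_diff_swap[of v w] V vertex_ultrafilter by simp
  with \<open>u - w = v - w\<close> show ?thesis by blast
qed

text \<open>
  Induction on the distance from \<open>u\<close> to a principal ultrafilter. Both \<open>h\<close> and the map induced by
  \<open>f\<close> are isometries with the same values on principal ultrafilters, so the two candidates for the
  image of \<open>u\<close> have equal distances to all of these, and they share a neighbour by induction.
\<close>

lemma graph_automorphism_extending:
  assumes f: "wall_automorphism X W f" and h: "graph_automorphism (C1 X W) h"
    and ext: "extends_to_C1 X W f h" and u: "u \<in> vertices"
  shows "h u = image f ` u"
proof -
  obtain x where x: "x \<in> X" using u by (auto simp: C1_def almost_principal_def)
  have hV: "h v \<in> vertices" if "v \<in> vertices" for v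
    using h that by (auto simp: graph_automorphism_def bij_betw_def)
  note iso = C1.graph_automorphism_isometry[OF h]
  note hp = ext[unfolded extends_to_C1_def, rule_format]
  show ?thesis using u
  proof (induction "card (u - principal W x)" arbitrary: u)
    case 0
    then have "u = principal W x" using C1.d_zero principal_vertex[OF x] by metis
    then show ?case using hp[OF x] image_principal[OF f x] by simp
  next
    case (Suc n)
    obtain w where w: "w \<in> vertices" "card (u - w) = 1" "card (w - principal W x) = n"
      using vertex_step[OF Suc.prems principal_vertex[OF x]] Suc.hyps(2) by metis
    have IH: "h w = image f ` w" using Suc.hyps(1) w by blast
    show ?case
    proof (rule neighbour_eqI)
      show "h u \<in> vertices" "image f ` u \<in> vertices" "h w \<in> vertices"
        using hV image_vertex[OF f] Suc.prems w by auto
      show "card (h u - h w) = 1" using iso Suc.prems w by simp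
      show "card (image f ` u - h w) = 1"
        unfolding IH using image_diff[OF f] Suc.prems w by simp
      fix y assume "y \<in> X"
      then obtain z where z: "z \<in> X" "y = f z"
        using automorphism_bij[OF f] by (auto simp: bij_betw_def)
      then show "card (h u - principal W y) = card (image f ` u - principal W y)"
        using iso[OF Suc.prems principal_vertex[OF z(1)]]
          image_diff[OF f Suc.prems principal_vertex[OF z(1)]]
          hp[OF z(1)] image_principal[OF f z(1)] by simp
    qed
  qed
qed

lemma image_action:
  assumes "wall_action G X W \<phi>"
  shows "graph_action G (C1 X W) (\<lambda>g\<in>carrier G. \<lambda>u\<in>vertices. image (\<phi> g) ` u)"
    (is "graph_action G _ ?\<psi>")
proof -
  interpret group_action G X \<phi> using assms by (simp add: wall_action_def)
  have G: "group G" using group_hom by (rule group_hom.axioms(1))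
  have aut: "wall_automorphism X W (\<phi> g)" if "g \<in> carrier G" for g
    using assms that by (simp add: wall_action_def)
  have \<psi>: "graph_automorphism (C1 X W) (?\<psi> g)" if "g \<in> carrier G" for g
    using image_graph_automorphism[OF aut[OF that]] that by simp
  have Bij: "?\<psi> g \<in> Bij vertices" if "g \<in> carrier G" for g
    using \<psi>[OF that] that by (auto simp: Bij_def graph_automorphism_def)
  have mult: "?\<psi> (g \<otimes>\<^bsub>G\<^esub> k) = compose vertices (?\<psi> g) (?\<psi> k)"
    if g: "g \<in> carrier G" and k: "k \<in> carrier G" for g k
  proof
    fix u
    have gk: "g \<otimes>\<^bsub>G\<^esub> k \<in> carrier G" using G g k by (simp add: group.is_monoid monoid.m_closed)
    show "?\<psi> (g \<otimes>\<^bsub>G\<^esub> k) u = compose vertices (?\<psi> g) (?\<psi> k) u"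
    proof (cases "u \<in> vertices")
      case True
      have "\<phi> (g \<otimes>\<^bsub>G\<^esub> k) ` A = \<phi> g ` \<phi> k ` A" if "A \<in> u" for A
      proof -
        have "A \<subseteq> X" using that True vertex_ultrafilter ultrafilter_halfspace halfspace_subset by blast
        then show ?thesis
          unfolding image_image using composition_rule g k by (intro image_cong) auto
      qed
      then show ?thesis
        using True gk g k image_vertex[OF aut[OF k]] by (auto simp: compose_def image_image)
    qed (use gk in \<open>simp add: compose_def\<close>)
  qed
  have "?\<psi> \<in> hom G (BijGroup vertices)"
    using Bij mult G by (intro homI) (simp_all add: BijGroup_def)
  then have "group_action G vertices ?\<psi>"
    using G group_BijGroup by (auto simp: group_action_def group_hom_def group_hom_axioms_def)
  then show ?thesis using \<psi> by (simp add: graph_action_def)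
qed

lemma unique_action:
  assumes "wall_action G X W \<phi>"
  shows "\<exists>!\<psi>. \<psi> \<in> extensional (carrier G) \<and> graph_action G (C1 X W) \<psi> \<and>
            (\<forall>g\<in>carrier G. extends_to_C1 X W (\<phi> g) (\<psi> g))"
proof (rule ex1I)
  let ?\<psi> = "\<lambda>g\<in>carrier G. \<lambda>u\<in>vertices. image (\<phi> g) ` u"
  have aut: "wall_automorphism X W (\<phi> g)" if "g \<in> carrier G" for g
    using assms that by (simp add: wall_action_def)
  show "?\<psi> \<in> extensional (carrier G) \<and> graph_action G (C1 X W) ?\<psi> \<and>
      (\<forall>g\<in>carrier G. extends_to_C1 X W (\<phi> g) (?\<psi> g))"
    using image_action[OF assms] image_extends[OF aut] by simp
  fix \<psi> assume \<psi>: "\<psi> \<in> extensional (carrier G) \<and> graph_action G (C1 X W) \<psi> \<and>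
      (\<forall>g\<in>carrier G. extends_to_C1 X W (\<phi> g) (\<psi> g))"
  have "\<psi> g = ?\<psi> g" if g: "g \<in> carrier G" for g
  proof (rule extensionalityI)
    have "group_action G vertices \<psi>" using \<psi> by (simp add: graph_action_def)
    then show "\<psi> g \<in> extensional vertices"
      using group_action.bij_prop0 g Bij_imp_extensional by metis
    show "?\<psi> g \<in> extensional vertices" using g by simp
    fix u assume "u \<in> vertices"
    then show "\<psi> g u = ?\<psi> g u"
      using graph_automorphism_extending[OF aut[OF g]] \<psi> g by (simp add: graph_action_def)
  qed
  then show "\<psi> = ?\<psi>"
    using \<psi> by (intro extensionalityI[of _ "carrier G"]) auto
qed

lemma median_automorphism_extending:
  assumes "wall_automorphism X W f" "median_automorphism (C1 X W) h" "extends_to_C1 X W f h"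
    and "u \<in> vertices"
  shows "h u = image f ` u"
  using graph_automorphism_extending C1.median_automorphism_imp_graph_automorphism assms by blast

lemma unique_median_automorphism:
  assumes f: "wall_automorphism X W f"
  shows "\<exists>!h. h \<in> extensional vertices \<and> median_automorphism (C1 X W) h \<and> extends_to_C1 X W f h"
proof (rule ex1I)
  let ?h = "\<lambda>u\<in>vertices. image f ` u"
  show "?h \<in> extensional vertices \<and> median_automorphism (C1 X W) ?h \<and> extends_to_C1 X W f ?h"
    using image_extends[OF f] image_graph_automorphism[OF f] C1_median_graph
      C1.graph_automorphism_imp_median_automorphism by auto
  fix h assume "h \<in> extensional vertices \<and> median_automorphism (C1 X W) h \<and> extends_to_C1 X W f h"
  then show "h = ?h"
    using median_automorphism_extending[OF f] by (intro extensionalityI[of _ vertices]) auto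
qed

lemmas median_automorphism_imp_graph_automorphism =
  C1.median_automorphism_imp_graph_automorphism

end


section \<open>Extension of automorphisms and of actions\<close>

theorem mainTheorem2:
  fixes X :: "'a set" and W :: "'a set set set"
  assumes "space_with_walls X W"
  shows
    "(\<forall>f. wall_automorphism X W f \<longrightarrow>
        (\<exists>!h. h \<in> extensional (pverts (C1 X W)) \<and>
            median_automorphism (C1 X W) h \<and> extends_to_C1 X W f h) \<and>
        (\<forall>h. median_automorphism (C1 X W) h \<and> extends_to_C1 X W f h \<longrightarrow>
            graph_automorphism (C1 X W) h \<and>
            (\<forall>\<omega>\<in>pverts (C1 X W). h \<omega> = {f ` A | A. A \<in> \<omega>}))) \<and>
     (\<forall>(G :: ('g, 'm) monoid_scheme) \<phi>. wall_action G X W \<phi> \<longrightarrow>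
        (\<exists>!\<psi>. \<psi> \<in> extensional (carrier G) \<and> graph_action G (C1 X W) \<psi> \<and>
            (\<forall>g\<in>carrier G. extends_to_C1 X W (\<phi> g) (\<psi> g))))"
proof -
  interpret space_with_walls X W by (rule assms)
  have image: "{f ` A | A. A \<in> \<omega>} = image f ` \<omega>" for f :: "'a \<Rightarrow> 'a" and \<omega>
    by blast
  show ?thesis
    unfolding image
  proof (intro conjI allI impI ballI)
    fix f assume f: "wall_automorphism X W f"
    show "\<exists>!h. h \<in> extensional vertices \<and> median_automorphism (C1 X W) h \<and> extends_to_C1 X W f h"
      using f by (rule unique_median_automorphism)
    fix h assume h: "median_automorphism (C1 X W) h \<and> extends_to_C1 X W f h"
    show "graph_automorphism (C1 X W) h"
      using h median_automorphism_imp_graph_automorphism by blast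
    fix u assume "u \<in> vertices"
    then show "h u = image f ` u"
      using median_automorphism_extending f h by blast
  next
    fix G :: "('g, 'm) monoid_scheme" and \<phi> assume "wall_action G X W \<phi>"
    then show "\<exists>!\<psi>. \<psi> \<in> extensional (carrier G) \<and> graph_action G (C1 X W) \<psi> \<and>
        (\<forall>g\<in>carrier G. extends_to_C1 X W (\<phi> g) (\<psi> g))"
      by (rule unique_action)
  qed
qed

end
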